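(* Let $G=(A,B,E)$ be a connected bipartite graph. Then the following assertions are equivalent: (i) $G$ is $\alpha$-stable; (ii) $G$ has perfect matchings and $\bigcap\{M : M \text{ is a perfect matching of } G\}=\emptyset$; (iii) $|A|=|B|$ and $\mu(G-e)=\mu(G)=\mu(G+u)$, for any $e\in E$ and $u\in E(\overline{G})$; (iv) $|A|=|B|$ and $\mu(G-e)=\mu(G)=\mu(G+u)$, for any $e\in E$ and $u\in E(\widetilde{G})$; (v) $\bigcap\{S : S \text{ is a stable set of } G,\ |S|=\alpha(G)\}=\bigcap\{M : M \text{ is a matching of } G,\ |M|=\mu(G)\}=\emptyset$.
   Context: All graphs are finite, simple and undirected. $G=(A,B,E)$ denotes a bipartite graph with color classes $A,B$ and edge set $E$. $\alpha(G)$ is the maximum size of a stable (independent) set and $\mu(G)$ the maximum size of a matching; a perfect matching is a matching covering all vertices. $G-e$ deletes the edge $e$ (keeping all vertices); $G+u$ adds the edge $u$. $\overline{G}$ is the complement of $G$, and $\widetilde{G}=(A,B,\widetilde{E})$ is the bipartite complement, with $\widetilde{E}=\{ab: a\in A,\ b\in B,\ ab\notin E\}$. $G$ is $\alpha^-$-stable if $\alpha(G-e)=\alpha(G)$ for every $e\in E(G)$; $\alpha^+$-stable if $\alpha(G+e)=\alpha(G)$ for every $e\in E(\overline{G})$; $\alpha$-stable if it is both.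
   Formalization: Both color classes A and B are assumed nonempty; among connected graphs this excludes only the one-vertex graph, which is vacuously α-stable but has no perfect matching, so that the stated equivalence fails for it. *)

theory Defs
  imports Main
begin

text \<open>
  A graph is given by its vertex set V and its edge set E, a set of two-element subsets of V.
  Deleting an edge e gives V, E - {e}; adding an edge u gives V, insert u E.
\<close>

definition simple_graph :: "'a set \<Rightarrow> 'a set set \<Rightarrow> bool" where
  "simple_graph V E \<longleftrightarrow> finite V \<and> (\<forall>e\<in>E. e \<subseteq> V \<and> card e = 2)"

definition bipartite_graph :: "'a set \<Rightarrow> 'a set \<Rightarrow> 'a set set \<Rightarrow> bool" where
  "bipartite_graph A B E \<longleftrightarrow>
     simple_graph (A \<union> B) E \<and> A \<inter> B = {} \<and> (\<forall>e\<in>E. \<exists>a\<in>A. \<exists>b\<in>B. e = {a, b})"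

definition connected_graph :: "'a set \<Rightarrow> 'a set set \<Rightarrow> bool" where
  "connected_graph V E \<longleftrightarrow>
     V \<noteq> {} \<and> (\<forall>u\<in>V. \<forall>v\<in>V. (u, v) \<in> {(x, y). {x, y} \<in> E}\<^sup>*)"

definition complement_edges :: "'a set \<Rightarrow> 'a set set \<Rightarrow> 'a set set" where
  "complement_edges V E = {e. e \<subseteq> V \<and> card e = 2 \<and> e \<notin> E}"

definition bipartite_complement_edges :: "'a set \<Rightarrow> 'a set \<Rightarrow> 'a set set \<Rightarrow> 'a set set" where
  "bipartite_complement_edges A B E = {{a, b} | a b. a \<in> A \<and> b \<in> B \<and> {a, b} \<notin> E}"

definition stable_set :: "'a set \<Rightarrow> 'a set set \<Rightarrow> 'a set \<Rightarrow> bool" where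
  "stable_set V E S \<longleftrightarrow> S \<subseteq> V \<and> (\<forall>u\<in>S. \<forall>v\<in>S. {u, v} \<notin> E)"

definition stability_number :: "'a set \<Rightarrow> 'a set set \<Rightarrow> nat" where
  "stability_number V E = Max (card ` {S. stable_set V E S})"

definition matching :: "'a set set \<Rightarrow> 'a set set \<Rightarrow> bool" where
  "matching E M \<longleftrightarrow> M \<subseteq> E \<and> pairwise disjnt M"

definition matching_number :: "'a set set \<Rightarrow> nat" where
  "matching_number E = Max (card ` {M. matching E M})"

definition perfect_matching :: "'a set \<Rightarrow> 'a set set \<Rightarrow> 'a set set \<Rightarrow> bool" where
  "perfect_matching V E M \<longleftrightarrow> matching E M \<and> \<Union>M = V"

definition alpha_minus_stable :: "'a set \<Rightarrow> 'a set set \<Rightarrow> bool" where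
  "alpha_minus_stable V E \<longleftrightarrow>
     (\<forall>e\<in>E. stability_number V (E - {e}) = stability_number V E)"

definition alpha_plus_stable :: "'a set \<Rightarrow> 'a set set \<Rightarrow> bool" where
  "alpha_plus_stable V E \<longleftrightarrow>
     (\<forall>e\<in>complement_edges V E. stability_number V (insert e E) = stability_number V E)"

definition alpha_stable :: "'a set \<Rightarrow> 'a set set \<Rightarrow> bool" where
  "alpha_stable V E \<longleftrightarrow> alpha_minus_stable V E \<and> alpha_plus_stable V E"

end

theory Submission
  imports Defs
begin

text \<open>
  Koenig's theorem \<open>\<alpha> + \<mu> = |V|\<close> splits each of the five assertions into the same two
  independent conditions.

  One condition concerns the deletion of edges. The identity also holds for \<open>G - e\<close>, hence
  \<open>\<alpha>(G - e) = \<alpha>(G)\<close> and \<open>\<mu>(G - e) = \<mu>(G)\<close> say the same thing; and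
  \<open>\<mu>(G - e) = \<mu>(G)\<close> means that some maximum matching avoids \<open>e\<close>. So \<open>\<alpha>\<^sup>-\<close>-stability, invariance
  of \<open>\<mu>\<close> under the deletion of edges, and the maximum matchings having no common edge are
  equivalent in every bipartite graph (\<open>alpha_minus_stable_iff_matching_number\<close>,
  \<open>matching_number_delete_iff_Inter_maximum\<close>).

  The other condition is the existence of a perfect matching. If there is one, both colour
  classes are maximum stable sets, so no vertex lies in all maximum stable sets, and since an
  added edge leaves one of the two classes stable, \<open>\<alpha>\<close> does not drop; \<open>\<mu> = |V| / 2\<close> cannot
  grow either. If there is none, let \<open>M\<close> be a maximum matching. Since \<open>|M| + |S| = |V|\<close> for
  every maximum stable set \<open>S\<close>, such an \<open>S\<close> contains every vertex that \<open>M\<close> leaves uncovered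
  and one end of every edge of \<open>M\<close>. Let \<open>v\<close> be uncovered, \<open>w\<close> a neighbour of \<open>v\<close>, and \<open>w'\<close> the
  partner of \<open>w\<close> in \<open>M\<close>: then \<open>v\<close> and \<open>w'\<close> lie in every maximum stable set, and
  adding the edge \<open>vw'\<close> lowers \<open>\<alpha>\<close>. If in addition the classes have equal size, then \<open>M\<close>
  leaves a vertex of each class uncovered, and joining these two raises \<open>\<mu>\<close>.

  Koenig's theorem is proved without alternating paths, by deleting edges as long as \<open>\<alpha>\<close> stays
  the same: when every edge is critical for \<open>\<alpha>\<close>, no two edges meet, and for such a graph the
  identity is immediate.
\<close>

section \<open>Stable sets and matchings in a simple graph\<close>

lemma simple_graph_finite_vertices: "simple_graph V E \<Longrightarrow> finite V"
  by (simp add: simple_graph_def)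

lemma simple_graph_finite_edges:
  assumes "simple_graph V E"
  shows "finite E"
proof (rule finite_subset)
  show "E \<subseteq> Pow V" using assms by (auto simp: simple_graph_def)
  show "finite (Pow V)" using assms by (simp add: simple_graph_def)
qed

lemma simple_graph_insert:
  "simple_graph V E \<Longrightarrow> u \<in> complement_edges V E \<Longrightarrow> simple_graph V (insert u E)"
  by (auto simp: simple_graph_def complement_edges_def)

lemma stable_set_antimono: "stable_set V E S \<Longrightarrow> F \<subseteq> E \<Longrightarrow> stable_set V F S"
  by (auto simp: stable_set_def)

lemma finite_stable_sets:
  assumes "finite V"
  shows "finite {S. stable_set V E S}"
  by (rule finite_subset[of _ "Pow V"]) (use assms in \<open>auto simp: stable_set_def\<close>)

lemma stable_set_card_le:
  assumes "finite V" "stable_set V E S"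
  shows "card S \<le> stability_number V E"
  unfolding stability_number_def
  by (rule Max_ge) (use assms finite_stable_sets in auto)

lemma obtain_maximum_stable_set:
  assumes "finite V"
  obtains S where "stable_set V E S" "card S = stability_number V E"
proof -
  have "stable_set V E {}" by (simp add: stable_set_def)
  then have "card ` {S. stable_set V E S} \<noteq> {}" by blast
  then have "stability_number V E \<in> card ` {S. stable_set V E S}"
    unfolding stability_number_def by (intro Max_in finite_imageI finite_stable_sets assms)
  then show thesis using that by force
qed

lemma stability_number_antimono:
  assumes "finite V" "F \<subseteq> E"
  shows "stability_number V E \<le> stability_number V F"
proof -
  obtain S where "stable_set V E S" "card S = stability_number V E"
    by (rule obtain_maximum_stable_set[OF assms(1)])
  then show ?thesis
    using stable_set_card_le[OF assms(1) stable_set_antimono[OF _ assms(2)]] by metis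
qed

lemma matching_mono: "matching E M \<Longrightarrow> E \<subseteq> F \<Longrightarrow> matching F M"
  by (auto simp: matching_def)

lemma finite_matchings:
  assumes "finite E"
  shows "finite {M. matching E M}"
  by (rule finite_subset[of _ "Pow E"]) (use assms in \<open>auto simp: matching_def\<close>)

lemma matching_card_le:
  assumes "finite E" "matching E M"
  shows "card M \<le> matching_number E"
  unfolding matching_number_def
  by (rule Max_ge) (use assms finite_matchings in auto)

lemma obtain_maximum_matching:
  assumes "finite E"
  obtains M where "matching E M" "card M = matching_number E"
proof -
  have "matching E {}" by (simp add: matching_def)
  then have "card ` {M. matching E M} \<noteq> {}" by blast
  then have "matching_number E \<in> card ` {M. matching E M}"
    unfolding matching_number_def by (intro Max_in finite_imageI finite_matchings assms)
  then show thesis using that by force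
qed

lemma matching_number_mono:
  assumes "finite F" "E \<subseteq> F"
  shows "matching_number E \<le> matching_number F"
proof -
  obtain M where "matching E M" "card M = matching_number E"
    by (rule obtain_maximum_matching[OF finite_subset[OF assms(2,1)]])
  then show ?thesis
    using matching_card_le[OF assms(1) matching_mono[OF _ assms(2)]] by metis
qed

lemma card_Union_matching:
  assumes "simple_graph V E" "matching E M"
  shows "card (\<Union>M) = 2 * card M"
proof -
  have *: "finite V" "\<And>e. e \<in> M \<Longrightarrow> e \<subseteq> V \<and> card e = 2"
    using assms by (auto simp: simple_graph_def matching_def)
  have "card (\<Union>M) = sum card M"
  proof (rule card_Union_disjoint)
    show "pairwise disjnt M" using assms(2) by (simp add: matching_def)
    show "finite e" if "e \<in> M" for e using *(2)[OF that] *(1) finite_subset by blast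
  qed
  then show ?thesis using * by simp
qed

lemma matching_Union_subset: "simple_graph V E \<Longrightarrow> matching E M \<Longrightarrow> \<Union>M \<subseteq> V"
  by (auto simp: simple_graph_def matching_def)

lemma perfect_matching_iff_card:
  assumes "simple_graph V E" "matching E M"
  shows "perfect_matching V E M \<longleftrightarrow> 2 * card M = card V"
  using card_Union_matching[OF assms] assms(2)
    card_subset_eq[OF simple_graph_finite_vertices[OF assms(1)] matching_Union_subset[OF assms]]
  unfolding perfect_matching_def by metis

lemma matching_insert_uncovered:
  assumes "finite E" "matching E M" "a \<notin> \<Union>M" "b \<notin> \<Union>M"
  shows "card M < matching_number (insert {a, b} E)"
proof -
  have "matching (insert {a, b} E) (insert {a, b} M)"
    using assms by (auto simp: matching_def pairwise_insert disjnt_def)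
  then have "card (insert {a, b} M) \<le> matching_number (insert {a, b} E)"
    using assms(1) by (intro matching_card_le) auto
  moreover have "finite M" using assms finite_subset by (auto simp: matching_def)
  moreover have "{a, b} \<notin> M" using assms by auto
  ultimately show ?thesis by simp
qed

text \<open>Each edge of the matching has an end outside the stable set, and these ends are
  distinct. Besides being the easy half of Koenig's theorem, the inequality is used below for
  subgraphs on fewer vertices.\<close>

lemma card_matching_add_card_stable_le:
  assumes "simple_graph V E" "matching E M" "stable_set V E S"
  shows "card M + card S \<le> card V"
proof -
  have V: "finite V" and E: "\<And>e. e \<in> M \<Longrightarrow> e \<in> E \<and> e \<subseteq> V \<and> card e = 2"
    using assms by (auto simp: simple_graph_def matching_def)
  have S: "S \<subseteq> V" using assms(3) by (simp add: stable_set_def)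
  have "\<exists>x. x \<in> e \<and> x \<notin> S" if "e \<in> M" for e
  proof -
    have "card e = 2" using E that by blast
    then obtain x y where "e = {x, y}" by (auto simp: card_2_iff)
    moreover have "e \<in> E" using E that by blast
    ultimately have "x \<notin> S \<or> y \<notin> S" using assms(3) by (auto simp: stable_set_def)
    then show ?thesis using \<open>e = {x, y}\<close> by blast
  qed
  then obtain f where f: "\<And>e. e \<in> M \<Longrightarrow> f e \<in> e \<and> f e \<notin> S" by metis
  have "inj_on f M"
  proof (rule inj_onI)
    fix d e assume "d \<in> M" "e \<in> M" "f d = f e"
    then have "f d \<in> d \<inter> e" using f[of d] f[of e] by simp
    then show "d = e"
      using assms(2) \<open>d \<in> M\<close> \<open>e \<in> M\<close> by (auto simp: matching_def pairwise_def disjnt_def)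
  qed
  moreover have "f ` M \<subseteq> V - S"
  proof
    fix x assume "x \<in> f ` M"
    then obtain e where "e \<in> M" "x = f e" by blast
    then show "x \<in> V - S" using f[of e] E[of e] by auto
  qed
  ultimately have "card M \<le> card (V - S)"
    using V by (intro card_inj_on_le) auto
  moreover have "card (V - S) = card V - card S" "card S \<le> card V"
    using V S by (auto simp: card_Diff_subset finite_subset card_mono)
  ultimately show ?thesis by linarith
qed

text \<open>An uncovered vertex outside \<open>S\<close> could be removed from the graph, leaving \<open>M\<close> and \<open>S\<close>
  too large for the rest.\<close>

lemma uncovered_in_tight_stable_set:
  assumes "simple_graph V E" "matching E M" "stable_set V E S"
    and "card M + card S = card V" and "v \<in> V" "v \<notin> \<Union>M"
  shows "v \<in> S"
proof (rule ccontr)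
  assume "v \<notin> S"
  then have "card M + card S \<le> card (V - {v})"
    using assms
    by (intro card_matching_add_card_stable_le[where E = M])
      (auto simp: simple_graph_def matching_def stable_set_def)
  then show False
    using assms simple_graph_finite_vertices[OF assms(1)]
    by (metis card_Diff1_less not_less)
qed

text \<open>An edge of \<open>M\<close> that misses \<open>S\<close> could be removed together with both of its ends: the
  matching would lose one edge, but the graph two vertices.\<close>

lemma matching_edge_meets_tight_stable_set:
  assumes "simple_graph V E" "matching E M" "stable_set V E S"
    and "card M + card S = card V" and "e \<in> M"
  shows "e \<inter> S \<noteq> {}"
proof
  assume "e \<inter> S = {}"
  have M: "pairwise disjnt M" "M \<subseteq> E" using assms(2) by (auto simp: matching_def)
  have "card (M - {e}) + card S \<le> card (V - e)"
  proof (rule card_matching_add_card_stable_le)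
    have "f \<inter> e = {}" if "f \<in> M - {e}" for f
      using M(1) assms(5) that by (auto simp: pairwise_def disjnt_def)
    then show "simple_graph (V - e) (M - {e})"
      using assms(1) M(2) unfolding simple_graph_def by blast
    show "matching (M - {e}) (M - {e})"
      using M(1) by (auto simp: matching_def intro: pairwise_subset)
    show "stable_set (V - e) (M - {e}) S"
      using assms(3) M(2) \<open>e \<inter> S = {}\<close> unfolding stable_set_def by blast
  qed
  moreover have e: "e \<subseteq> V" "card e = 2" "finite V"
    using assms by (auto simp: simple_graph_def matching_def)
  moreover have "finite M"
    using assms simple_graph_finite_edges[OF assms(1)] finite_subset
    by (auto simp: matching_def)
  moreover have "card (V - e) = card V - 2"
    using e by (simp add: card_Diff_subset finite_subset)
  moreover have "2 \<le> card V" using e card_mono by metis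
  ultimately show False using assms(4,5) by (simp add: card_Diff_singleton)
qed

text \<open>A matching that avoids \<open>e\<close> is a matching of \<open>G - e\<close>, so \<open>\<mu>\<close> survives the deletion of \<open>e\<close>
  exactly when some maximum matching avoids \<open>e\<close>.\<close>

lemma matching_number_delete_iff_Inter_maximum:
  assumes "finite E"
  shows "(\<forall>e\<in>E. matching_number (E - {e}) = matching_number E) \<longleftrightarrow>
    \<Inter>{M. matching E M \<and> card M = matching_number E} = {}"
    (is "?L \<longleftrightarrow> \<Inter>?X = {}")
proof -
  have "matching_number (E - {e}) = matching_number E \<longleftrightarrow> (\<exists>M\<in>?X. e \<notin> M)" for e
  proof
    assume eq: "matching_number (E - {e}) = matching_number E"
    obtain M where "matching (E - {e}) M" "card M = matching_number (E - {e})"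
      by (rule obtain_maximum_matching[of "E - {e}"]) (use assms in auto)
    with eq show "\<exists>M\<in>?X. e \<notin> M"
      by (intro bexI[of _ M]) (auto simp: matching_def)
  next
    assume "\<exists>M\<in>?X. e \<notin> M"
    then obtain M where M: "matching E M" "card M = matching_number E" "e \<notin> M" by blast
    then have "matching (E - {e}) M" by (auto simp: matching_def)
    from matching_card_le[OF _ this] M assms
    have "matching_number E \<le> matching_number (E - {e})" by simp
    moreover have "matching_number (E - {e}) \<le> matching_number E"
      using assms by (intro matching_number_mono) auto
    ultimately show "matching_number (E - {e}) = matching_number E" by simp
  qed
  moreover obtain M where "M \<in> ?X" "M \<subseteq> E"
    by (rule obtain_maximum_matching[OF assms]) (auto simp: matching_def)
  ultimately show ?thesis by blast
qed

section \<open>Koenig's theorem\<close>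

lemma bipartite_simple: "bipartite_graph A B E \<Longrightarrow> simple_graph (A \<union> B) E"
  by (simp add: bipartite_graph_def)

lemma bipartite_swap: "bipartite_graph A B E \<Longrightarrow> bipartite_graph B A E"
  unfolding bipartite_graph_def by (metis Un_commute Int_commute insert_commute)

lemma bipartite_subset: "bipartite_graph A B E \<Longrightarrow> F \<subseteq> E \<Longrightarrow> bipartite_graph A B F"
  by (auto simp: bipartite_graph_def simple_graph_def)

lemma bipartite_stable_setI:
  assumes "bipartite_graph A B E" "S \<subseteq> A \<union> B"
    and "\<And>a b. a \<in> A \<Longrightarrow> b \<in> B \<Longrightarrow> a \<in> S \<Longrightarrow> b \<in> S \<Longrightarrow> {a, b} \<notin> E"
  shows "stable_set (A \<union> B) E S"
  unfolding stable_set_def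
proof (intro conjI ballI notI)
  fix u v assume "u \<in> S" "v \<in> S" and uv: "{u, v} \<in> E"
  obtain a b where "a \<in> A" "b \<in> B" "{u, v} = {a, b}"
    using assms(1) uv unfolding bipartite_graph_def by metis
  then show False
    using assms(3) uv \<open>u \<in> S\<close> \<open>v \<in> S\<close> by (metis doubleton_eq_iff)
qed (rule assms(2))

lemma bipartite_class_stable:
  assumes "bipartite_graph A B E"
  shows "stable_set (A \<union> B) E A"
proof (rule bipartite_stable_setI[OF assms])
  fix a b assume "b \<in> B" "b \<in> A"
  then show "{a, b} \<notin> E" using assms by (auto simp: bipartite_graph_def)
qed simp

text \<open>Let the edges \<open>xy\<close> and \<open>xz\<close> be critical, and let \<open>S\<close> and \<open>T\<close> be sets of more than
  \<open>\<alpha>\<close> vertices that become stable when \<open>xy\<close>, respectively \<open>xz\<close>, is deleted. Then \<open>x\<close> and \<open>y\<close> lie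
  in \<open>S\<close>, \<open>x\<close> and \<open>z\<close> lie in \<open>T\<close>, and \<open>y\<close> is not in \<open>T\<close>, \<open>z\<close> not in \<open>S\<close>. Take the union of
  \<open>S\<close> and \<open>T\<close> in the class of \<open>x\<close> and their intersection in the other class, and vice versa.
  The first of these sets is stable in the whole graph, and so is the second one once \<open>x\<close> is
  dropped. Together they still have at least \<open>2 \<alpha> + 1\<close> vertices, so one of them has more than
  \<open>\<alpha>\<close>.\<close>

lemma critical_edges_disjoint_aux:
  assumes bip: "bipartite_graph A B E"
    and x: "x \<in> A" and e: "{x, y} \<in> E" and f: "{x, z} \<in> E" and "y \<noteq> z"
    and "stability_number (A \<union> B) E < stability_number (A \<union> B) (E - {{x, y}})"
    and "stability_number (A \<union> B) E < stability_number (A \<union> B) (E - {{x, z}})"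
  shows False
proof -
  let ?V = "A \<union> B"
  have fin: "finite A" "finite B" and AB: "A \<inter> B = {}"
    using bip by (auto simp: bipartite_graph_def simple_graph_def)
  then have finV: "finite ?V" by simp
  obtain S where S: "stable_set ?V (E - {{x, y}}) S" "stability_number ?V E < card S"
    using obtain_maximum_stable_set[OF finV, of "E - {{x, y}}"] assms(6) by metis
  obtain T where T: "stable_set ?V (E - {{x, z}}) T" "stability_number ?V E < card T"
    using obtain_maximum_stable_set[OF finV, of "E - {{x, z}}"] assms(7) by metis
  have SV: "S \<subseteq> ?V" and TV: "T \<subseteq> ?V" using S T by (auto simp: stable_set_def)
  have S_edge: "{u, v} = {x, y}" if "u \<in> S" "v \<in> S" "{u, v} \<in> E" for u v
    using S(1) that by (auto simp: stable_set_def)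
  have T_edge: "{u, v} = {x, z}" if "u \<in> T" "v \<in> T" "{u, v} \<in> E" for u v
    using T(1) that by (auto simp: stable_set_def)
  have "\<not> stable_set ?V E S" using stable_set_card_le[OF finV] S(2) by (metis not_less)
  then have xyS: "x \<in> S" "y \<in> S"
    using S_edge SV unfolding stable_set_def by (metis doubleton_eq_iff)+
  have "\<not> stable_set ?V E T" using stable_set_card_le[OF finV] T(2) by (metis not_less)
  then have xzT: "x \<in> T" "z \<in> T"
    using T_edge TV unfolding stable_set_def by (metis doubleton_eq_iff)+
  have yT: "y \<notin> T" using T_edge[OF xzT(1) _ e] \<open>y \<noteq> z\<close> by (auto simp: doubleton_eq_iff)
  have zS: "z \<notin> S" using S_edge[OF xyS(1) _ f] \<open>y \<noteq> z\<close> by (auto simp: doubleton_eq_iff)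
  define P where "P = (S \<union> T) \<inter> A \<union> S \<inter> T \<inter> B"
  define Q where "Q = (S \<inter> T \<inter> A - {x}) \<union> (S \<union> T) \<inter> B"
  have "stable_set ?V E P"
  proof (rule bipartite_stable_setI[OF bip])
    fix a b assume "a \<in> A" "b \<in> B" "a \<in> P" "b \<in> P"
    then have "a \<in> S \<or> a \<in> T" "b \<in> S" "b \<in> T" using AB by (auto simp: P_def)
    then show "{a, b} \<notin> E"
      using S_edge[of a b] T_edge[of a b] x \<open>b \<in> B\<close> AB yT zS
      by (auto simp: doubleton_eq_iff)
  qed (auto simp: P_def)
  moreover have "stable_set ?V E Q"
  proof (rule bipartite_stable_setI[OF bip])
    fix a b assume "a \<in> A" "b \<in> B" "a \<in> Q" "b \<in> Q"
    then have "a \<in> S" "a \<in> T" "a \<noteq> x" "b \<in> S \<or> b \<in> T" using AB by (auto simp: Q_def)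
    then show "{a, b} \<notin> E"
      using S_edge[of a b] T_edge[of a b] x \<open>b \<in> B\<close> AB
      by (auto simp: doubleton_eq_iff)
  qed (auto simp: Q_def)
  ultimately have le: "card P \<le> stability_number ?V E" "card Q \<le> stability_number ?V E"
    using stable_set_card_le[OF finV] by auto
  have modular: "card (S \<inter> X \<union> T \<inter> X) + card (S \<inter> T \<inter> X) = card (S \<inter> X) + card (T \<inter> X)"
    if "finite X" for X
    using card_Un_Int[of "S \<inter> X" "T \<inter> X"] that
    by (simp add: Int_ac)
  have split: "card W = card (W \<inter> A) + card (W \<inter> B)" if "W \<subseteq> ?V" for W
  proof -
    have "card (W \<inter> A \<union> W \<inter> B) = card (W \<inter> A) + card (W \<inter> B)"
      using fin AB by (intro card_Un_disjoint) auto
    then show ?thesis using that by (metis Int_Un_distrib Int_absorb2)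
  qed
  have "card P = card (S \<inter> A \<union> T \<inter> A) + card (S \<inter> T \<inter> B)"
    unfolding P_def Int_Un_distrib2 using fin AB by (intro card_Un_disjoint) auto
  moreover have "card Q = card (S \<inter> T \<inter> A - {x}) + card (S \<inter> B \<union> T \<inter> B)"
    unfolding Q_def Int_Un_distrib2 using fin AB by (intro card_Un_disjoint) auto
  moreover have "card (S \<inter> T \<inter> A) = Suc (card (S \<inter> T \<inter> A - {x}))"
    using fin xyS xzT x by (intro card.remove) auto
  ultimately have "Suc (card P + card Q) = card S + card T"
    using modular[OF fin(1)] modular[OF fin(2)] split[OF SV] split[OF TV] by linarith
  then show False using le S(2) T(2) by linarith
qed

lemma critical_edges_form_matching:
  assumes bip: "bipartite_graph A B E"
    and crit: "\<And>e. e \<in> E \<Longrightarrow>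
      stability_number (A \<union> B) E < stability_number (A \<union> B) (E - {e})"
  shows "matching E E"
  unfolding matching_def pairwise_def
proof (intro conjI ballI impI)
  fix e f assume ef: "e \<in> E" "f \<in> E" "e \<noteq> f"
  show "disjnt e f"
  proof (rule ccontr)
    assume "\<not> disjnt e f"
    then obtain x where x: "x \<in> e" "x \<in> f" by (auto simp: disjnt_def)
    have sg: "e \<subseteq> A \<union> B" "card e = 2" "card f = 2"
      using bip ef by (auto simp: bipartite_graph_def simple_graph_def)
    have "\<exists>y. g = {x, y}" if "x \<in> g" "card g = 2" for g
      using that by (auto simp: card_2_iff)
    then obtain y z where yz: "e = {x, y}" "f = {x, z}" using sg x by metis
    have "y \<noteq> z" using yz ef by auto
    have "x \<in> A \<or> x \<in> B" using sg x by auto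
    then show False
    proof
      assume "x \<in> A"
      then show False
        using critical_edges_disjoint_aux[OF bip _ _ _ \<open>y \<noteq> z\<close>] crit ef yz by blast
    next
      assume "x \<in> B"
      then show False
        using critical_edges_disjoint_aux[OF bipartite_swap[OF bip] _ _ _ \<open>y \<noteq> z\<close>] crit ef yz
        by (simp add: Un_commute)
    qed
  qed
qed simp

text \<open>Deleting an edge that is not critical keeps \<open>\<alpha>\<close> and does not raise \<open>\<mu>\<close>. When no such edge
  is left, the edges form a matching, and removing one end of each of them from \<open>V\<close> leaves a
  stable set.\<close>

lemma koenig_le:
  assumes "bipartite_graph A B E"
  shows "card (A \<union> B) \<le> stability_number (A \<union> B) E + matching_number E"
proof -
  have "finite E" using assms bipartite_simple simple_graph_finite_edges by blast
  then show ?thesis using assms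
  proof (induction E rule: finite_psubset_induct)
    case (psubset E)
    let ?V = "A \<union> B"
    have finV: "finite ?V" using psubset.prems by (simp add: bipartite_graph_def simple_graph_def)
    show ?case
    proof (cases "\<exists>e\<in>E. stability_number ?V (E - {e}) \<le> stability_number ?V E")
      case True
      then obtain e where e: "e \<in> E" "stability_number ?V (E - {e}) \<le> stability_number ?V E"
        by blast
      have "card ?V \<le> stability_number ?V (E - {e}) + matching_number (E - {e})"
        using psubset.IH[of "E - {e}"] e bipartite_subset[OF psubset.prems] by blast
      moreover have "matching_number (E - {e}) \<le> matching_number E"
        using psubset.hyps by (intro matching_number_mono) auto
      ultimately show ?thesis using e by linarith
    next
      case False
      then have M: "matching E E"
        using critical_edges_form_matching[OF psubset.prems] by (meson not_le)
      obtain g where g: "\<And>e. e \<in> E \<Longrightarrow> g e \<in> A \<and> (\<exists>b\<in>B. e = {g e, b})"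
        using psubset.prems unfolding bipartite_graph_def by metis
      have "stable_set ?V E (?V - g ` E)"
      proof (rule bipartite_stable_setI[OF psubset.prems])
        fix a b assume ab: "a \<in> A" "b \<in> B" "a \<in> ?V - g ` E"
        have AB: "A \<inter> B = {}" using psubset.prems by (simp add: bipartite_graph_def)
        show "{a, b} \<notin> E"
        proof
          assume "{a, b} \<in> E"
          with g ab AB have "g {a, b} = a" by (metis disjoint_iff doubleton_eq_iff)
          with ab \<open>{a, b} \<in> E\<close> show False by force
        qed
      qed auto
      then have "card (?V - g ` E) \<le> stability_number ?V E"
        by (rule stable_set_card_le[OF finV])
      moreover have "card ?V - card (g ` E) \<le> card (?V - g ` E)"
        using psubset.hyps by (intro diff_card_le_card_Diff) auto
      moreover have "card (g ` E) \<le> card E" using psubset.hyps by (rule card_image_le)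
      moreover have "card E \<le> matching_number E" using matching_card_le[OF psubset.hyps M] .
      ultimately show ?thesis by linarith
    qed
  qed
qed

theorem koenig:
  assumes "bipartite_graph A B E"
  shows "matching_number E + stability_number (A \<union> B) E = card (A \<union> B)"
proof -
  note sg = bipartite_simple[OF assms]
  obtain M where "matching E M" "card M = matching_number E"
    by (rule obtain_maximum_matching[OF simple_graph_finite_edges[OF sg]])
  moreover obtain S where "stable_set (A \<union> B) E S" "card S = stability_number (A \<union> B) E"
    by (rule obtain_maximum_stable_set[OF simple_graph_finite_vertices[OF sg]])
  ultimately have "matching_number E + stability_number (A \<union> B) E \<le> card (A \<union> B)"
    using card_matching_add_card_stable_le[OF sg] by metis
  with koenig_le[OF assms] show ?thesis by linarith
qed

lemma alpha_minus_stable_iff_matching_number: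
  assumes "bipartite_graph A B E"
  shows "alpha_minus_stable (A \<union> B) E \<longleftrightarrow>
    (\<forall>e\<in>E. matching_number (E - {e}) = matching_number E)"
proof -
  have "stability_number (A \<union> B) (E - {e}) = stability_number (A \<union> B) E \<longleftrightarrow>
    matching_number (E - {e}) = matching_number E" for e
    using koenig[OF assms] koenig[OF bipartite_subset[OF assms Diff_subset[of E "{e}"]]]
    by linarith
  then show ?thesis by (simp add: alpha_minus_stable_def)
qed

section \<open>Consequences of a perfect matching\<close>

lemma perfect_matching_card_classes:
  assumes bip: "bipartite_graph A B E" and "perfect_matching (A \<union> B) E M"
  shows "card A = card M" "card B = card M"
proof -
  note sg = bipartite_simple[OF bip]
  have M: "matching E M" using assms(2) by (simp add: perfect_matching_def)
  have "card (A \<union> B) = 2 * card M" using perfect_matching_iff_card[OF sg M] assms(2) by simp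
  moreover have "card (A \<union> B) = card A + card B"
    using bip by (intro card_Un_disjoint) (auto simp: bipartite_graph_def simple_graph_def)
  moreover have "card M + card A \<le> card (A \<union> B)"
    by (rule card_matching_add_card_stable_le[OF sg M bipartite_class_stable[OF bip]])
  moreover have "card M + card B \<le> card (A \<union> B)"
    using card_matching_add_card_stable_le[OF sg M] bipartite_class_stable[OF bipartite_swap[OF bip]]
    by (simp add: Un_commute)
  ultimately show "card A = card M" "card B = card M" by linarith+
qed

lemma perfect_matching_numbers:
  assumes bip: "bipartite_graph A B E" and P: "perfect_matching (A \<union> B) E M"
  shows "matching_number E = card M" "stability_number (A \<union> B) E = card M"
proof -
  note sg = bipartite_simple[OF bip]
  have M: "matching E M" using P by (simp add: perfect_matching_def)
  have V: "card (A \<union> B) = 2 * card M" using perfect_matching_iff_card[OF sg M] P by simp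
  have "card A \<le> stability_number (A \<union> B) E"
    using stable_set_card_le[OF simple_graph_finite_vertices[OF sg] bipartite_class_stable[OF bip]] .
  moreover have "card M \<le> matching_number E"
    using matching_card_le[OF simple_graph_finite_edges[OF sg] M] .
  ultimately show "matching_number E = card M" "stability_number (A \<union> B) E = card M"
    using koenig[OF bip] V perfect_matching_card_classes[OF assms] by linarith+
qed

lemma perfect_iff_maximum_matching:
  assumes bip: "bipartite_graph A B E" and P: "\<exists>M. perfect_matching (A \<union> B) E M"
  shows "perfect_matching (A \<union> B) E N \<longleftrightarrow> matching E N \<and> card N = matching_number E"
proof -
  note sg = bipartite_simple[OF bip]
  obtain M where M: "perfect_matching (A \<union> B) E M" using P by blast
  then have "card (A \<union> B) = 2 * matching_number E"
    using perfect_matching_iff_card[OF sg, of M] perfect_matching_numbers[OF bip M]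
    by (simp add: perfect_matching_def)
  then show ?thesis
    using perfect_matching_iff_card[OF sg, of N] by (auto simp: perfect_matching_def)
qed

lemma perfect_matching_number_insert:
  assumes sg: "simple_graph V E" and P: "perfect_matching V E M"
    and u: "u \<in> complement_edges V E"
  shows "matching_number E = matching_number (insert u E)"
proof -
  note sg' = simple_graph_insert[OF sg u]
  have M: "matching E M" using P by (simp add: perfect_matching_def)
  obtain N where N: "matching (insert u E) N" "card N = matching_number (insert u E)"
    by (rule obtain_maximum_matching[OF simple_graph_finite_edges[OF sg']])
  have "2 * card N \<le> card V"
    using card_Union_matching[OF sg' N(1)] matching_Union_subset[OF sg' N(1)]
      card_mono[OF simple_graph_finite_vertices[OF sg]] by metis
  also have "\<dots> = 2 * card M" using perfect_matching_iff_card[OF sg M] P by simp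
  finally have "matching_number (insert u E) \<le> matching_number E"
    using N matching_card_le[OF simple_graph_finite_edges[OF sg] M] by linarith
  moreover have "matching_number E \<le> matching_number (insert u E)"
    using simple_graph_finite_edges[OF sg'] by (intro matching_number_mono) auto
  ultimately show ?thesis by simp
qed

text \<open>An added edge has at most one of the two classes as a superset, so the other class stays
  stable, and both classes are maximum stable sets.\<close>

lemma perfect_matching_imp_alpha_plus_stable:
  assumes bip: "bipartite_graph A B E" and P: "perfect_matching (A \<union> B) E M"
  shows "alpha_plus_stable (A \<union> B) E"
  unfolding alpha_plus_stable_def
proof
  fix u assume u: "u \<in> complement_edges (A \<union> B) E"
  have finV: "finite (A \<union> B)" and AB: "A \<inter> B = {}"
    using bip by (auto simp: bipartite_graph_def simple_graph_def)
  have "card u = 2" using u by (simp add: complement_edges_def)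
  then have "\<not> u \<subseteq> A \<or> \<not> u \<subseteq> B" using AB by (auto simp: card_2_iff)
  moreover have stays: "stable_set (A \<union> B) (insert u E) C"
    if "stable_set (A \<union> B) E C" "\<not> u \<subseteq> C" for C
    using that unfolding stable_set_def by auto
  moreover have "stable_set (A \<union> B) E B"
    using bipartite_class_stable[OF bipartite_swap[OF bip]] by (simp add: Un_commute)
  ultimately have "\<exists>C. stable_set (A \<union> B) (insert u E) C \<and> card C = card M"
    using bipartite_class_stable[OF bip] perfect_matching_card_classes[OF bip P] by metis
  then have "stability_number (A \<union> B) E \<le> stability_number (A \<union> B) (insert u E)"
    using stable_set_card_le[OF finV] perfect_matching_numbers[OF bip P] by metis
  moreover have "stability_number (A \<union> B) (insert u E) \<le> stability_number (A \<union> B) E"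
    using finV by (intro stability_number_antimono) auto
  ultimately show "stability_number (A \<union> B) (insert u E) = stability_number (A \<union> B) E" by simp
qed

section \<open>Characterisations of graphs with a perfect matching\<close>

lemma obtain_uncovered_vertex:
  assumes sg: "simple_graph V E" and "\<nexists>M. perfect_matching V E M"
  obtains M v where "matching E M" "card M = matching_number E" "v \<in> V" "v \<notin> \<Union>M"
proof -
  obtain M where M: "matching E M" "card M = matching_number E"
    by (rule obtain_maximum_matching[OF simple_graph_finite_edges[OF sg]])
  then have "\<Union>M \<noteq> V" using assms(2) by (auto simp: perfect_matching_def)
  then show thesis using matching_Union_subset[OF sg M(1)] M that by blast
qed

lemma Inter_maximum_stable_iff_perfect:
  assumes bip: "bipartite_graph A B E"
  shows "\<Inter>{S. stable_set (A \<union> B) E S \<and> card S = stability_number (A \<union> B) E} = {} \<longleftrightarrow>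
    (\<exists>M. perfect_matching (A \<union> B) E M)" (is "\<Inter>?X = {} \<longleftrightarrow> ?P")
proof
  note sg = bipartite_simple[OF bip]
  assume empty: "\<Inter>?X = {}"
  show ?P
  proof (rule ccontr)
    assume "\<not> ?P"
    then obtain M v where M: "matching E M" "card M = matching_number E"
      and v: "v \<in> A \<union> B" "v \<notin> \<Union>M"
      using obtain_uncovered_vertex[OF sg] by metis
    have "v \<in> S" if "S \<in> ?X" for S
      using that uncovered_in_tight_stable_set[OF sg M(1) _ _ v] koenig[OF bip] M(2) by auto
    then show False using empty by blast
  qed
next
  assume ?P
  then obtain M where P: "perfect_matching (A \<union> B) E M" by blast
  have "A \<in> ?X" "B \<in> ?X"
    using bipartite_class_stable[OF bip] bipartite_class_stable[OF bipartite_swap[OF bip]]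
      perfect_matching_card_classes[OF bip P] perfect_matching_numbers[OF bip P]
    by (auto simp: Un_commute)
  then have "\<Inter>?X \<subseteq> A \<inter> B" by blast
  then show "\<Inter>?X = {}" using bip by (auto simp: bipartite_graph_def)
qed

lemma connected_has_neighbour:
  assumes "connected_graph V E" "v \<in> V" "u \<in> V" "u \<noteq> v"
  obtains w where "{v, w} \<in> E"
proof -
  have "(v, u) \<in> {(x, y). {x, y} \<in> E}\<^sup>*" using assms by (simp add: connected_graph_def)
  then show thesis using assms(4) that by (cases rule: converse_rtranclE) auto
qed

text \<open>Without a perfect matching, some maximum matching leaves a vertex \<open>v\<close> uncovered. Every maximum
  stable set contains \<open>v\<close>, hence none of its neighbours, hence the partner of each matched
  neighbour; a graph in which two vertices lie in all maximum stable sets is not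
  \<open>\<alpha>\<^sup>+\<close>-stable.\<close>

lemma alpha_plus_stable_iff_perfect:
  assumes bip: "bipartite_graph A B E" and ne: "A \<noteq> {}" "B \<noteq> {}"
    and conn: "connected_graph (A \<union> B) E"
  shows "alpha_plus_stable (A \<union> B) E \<longleftrightarrow> (\<exists>M. perfect_matching (A \<union> B) E M)" (is "_ \<longleftrightarrow> ?P")
proof
  let ?V = "A \<union> B"
  note sg = bipartite_simple[OF bip]
  note finV = simple_graph_finite_vertices[OF sg]
  assume plus: "alpha_plus_stable ?V E"
  show ?P
  proof (rule ccontr)
    assume "\<not> ?P"
    then obtain M v where M: "matching E M" "card M = matching_number E"
      and v: "v \<in> ?V" "v \<notin> \<Union>M"
      using obtain_uncovered_vertex[OF sg] by metis
    have tight: "card M + card S = card ?V" if "card S = stability_number ?V E" for S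
      using that koenig[OF bip] M(2) by simp
    have v_in: "v \<in> S" if "stable_set ?V E S" "card S = stability_number ?V E" for S
      using uncovered_in_tight_stable_set[OF sg M(1) that(1) tight[OF that(2)] v] .
    obtain u where "u \<in> ?V" "u \<noteq> v"
      using ne v bip unfolding bipartite_graph_def by blast
    then obtain w where w: "{v, w} \<in> E" using connected_has_neighbour[OF conn v(1)] by metis
    have w_notin: "w \<notin> S" if "stable_set ?V E S" "card S = stability_number ?V E" for S
      using v_in[OF that] that(1) w by (auto simp: stable_set_def)
    obtain S where S: "stable_set ?V E S" "card S = stability_number ?V E"
      by (rule obtain_maximum_stable_set[OF finV])
    have "w \<in> ?V" using w sg by (auto simp: simple_graph_def)
    then have "w \<in> \<Union>M"
      using uncovered_in_tight_stable_set[OF sg M(1) S(1) tight[OF S(2)]] w_notin[OF S] by blast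
    then obtain e where e: "e \<in> M" "w \<in> e" by blast
    then have "card e = 2" using M(1) sg by (auto simp: matching_def simple_graph_def)
    with e obtain w' where w': "e = {w, w'}" by (auto simp: card_2_iff)
    have w'_in: "w' \<in> T" if "stable_set ?V E T" "card T = stability_number ?V E" for T
      using matching_edge_meets_tight_stable_set[OF sg M(1) that(1) tight[OF that(2)] e(1)]
        w_notin[OF that] w' by auto
    have "v \<noteq> w'" using v e w' by auto
    then have "{v, w'} \<in> complement_edges ?V E"
      using v_in[OF S] w'_in[OF S] S(1) by (auto simp: complement_edges_def stable_set_def)
    then have eq: "stability_number ?V (insert {v, w'} E) = stability_number ?V E"
      using plus by (simp add: alpha_plus_stable_def)
    obtain T where T: "stable_set ?V (insert {v, w'} E) T"
      "card T = stability_number ?V (insert {v, w'} E)"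
      by (rule obtain_maximum_stable_set[OF finV])
    have "stable_set ?V E T" using stable_set_antimono[OF T(1)] by blast
    then have "v \<in> T" "w' \<in> T" using v_in w'_in T(2) eq by auto
    then show False using T(1) by (auto simp: stable_set_def)
  qed
next
  assume ?P
  then show "alpha_plus_stable (A \<union> B) E"
    using perfect_matching_imp_alpha_plus_stable[OF bip] by blast
qed

text \<open>\<open>A\<close> is a stable set of the graph \<open>M\<close> on the vertices that \<open>M\<close> covers, which gives
  \<open>|A| \<le> |M|\<close>.\<close>

lemma perfect_if_covers_class:
  assumes bip: "bipartite_graph A B E" and eq: "card A = card B"
    and M: "matching E M" and cover: "A \<subseteq> \<Union>M"
  shows "perfect_matching (A \<union> B) E M"
proof -
  note sg = bipartite_simple[OF bip]
  have finV: "finite (A \<union> B)" using sg by (rule simple_graph_finite_vertices)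
  have U: "\<Union>M \<subseteq> A \<union> B" by (rule matching_Union_subset[OF sg M])
  have "card M + card A \<le> card (\<Union>M)"
  proof (rule card_matching_add_card_stable_le)
    show "simple_graph (\<Union>M) M"
      using sg M finite_subset[OF U finV] by (auto simp: simple_graph_def matching_def)
    show "matching M M" using M by (simp add: matching_def)
    show "stable_set (\<Union>M) M A"
      using bipartite_class_stable[OF bip] M cover by (auto simp: stable_set_def matching_def)
  qed
  moreover have "card (A \<union> B) \<le> card A + card B" by (rule card_Un_le)
  moreover have "card (\<Union>M) \<le> card (A \<union> B)" using card_mono[OF finV U] .
  ultimately have "2 * card M = card (A \<union> B)"
    using card_Union_matching[OF sg M] eq by linarith
  then show ?thesis using perfect_matching_iff_card[OF sg M] by simp
qed

lemma bipartite_complement_subset: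
  assumes "A \<inter> B = {}"
  shows "bipartite_complement_edges A B E \<subseteq> complement_edges (A \<union> B) E"
proof
  fix u assume "u \<in> bipartite_complement_edges A B E"
  then obtain a b where u: "u = {a, b}" "a \<in> A" "b \<in> B" "u \<notin> E"
    by (auto simp: bipartite_complement_edges_def)
  with assms have "a \<noteq> b" by blast
  with u show "u \<in> complement_edges (A \<union> B) E" by (auto simp: complement_edges_def)
qed

lemma matching_number_bipartite_insert_imp_perfect:
  assumes bip: "bipartite_graph A B E" and eq: "card A = card B"
    and ins: "\<forall>u\<in>bipartite_complement_edges A B E. matching_number E = matching_number (insert u E)"
  shows "\<exists>M. perfect_matching (A \<union> B) E M"
proof (rule ccontr)
  note sg = bipartite_simple[OF bip]
  note finE = simple_graph_finite_edges[OF sg]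
  assume none: "\<nexists>M. perfect_matching (A \<union> B) E M"
  obtain M where M: "matching E M" "card M = matching_number E"
    by (rule obtain_maximum_matching[OF finE])
  obtain a where a: "a \<in> A" "a \<notin> \<Union>M"
    using perfect_if_covers_class[OF bip eq M(1)] none by blast
  obtain b where b: "b \<in> B" "b \<notin> \<Union>M"
    using perfect_if_covers_class[OF bipartite_swap[OF bip] eq[symmetric] M(1)] none
    by (auto simp: Un_commute)
  have "matching_number E < matching_number (insert {a, b} E)"
    using matching_insert_uncovered[OF finE M(1) a(2) b(2)] M(2) by simp
  moreover have "matching_number (insert {a, b} E) = matching_number E"
  proof (cases "{a, b} \<in> E")
    case True
    then show ?thesis by (simp add: insert_absorb)
  next
    case False
    then have "{a, b} \<in> bipartite_complement_edges A B E"
      using a b by (auto simp: bipartite_complement_edges_def)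
    then show ?thesis using ins by metis
  qed
  ultimately show False by simp
qed

section \<open>The equivalence\<close>

theorem theorem5p2:
  fixes A B :: "'a set" and E :: "'a set set"
  assumes "bipartite_graph A B E"
    and "A \<noteq> {}" and "B \<noteq> {}"
    and "connected_graph (A \<union> B) E"
  shows
    "(alpha_stable (A \<union> B) E \<longleftrightarrow>
        (\<exists>M. perfect_matching (A \<union> B) E M) \<and> \<Inter>{M. perfect_matching (A \<union> B) E M} = {}) \<and>
     (alpha_stable (A \<union> B) E \<longleftrightarrow>
        card A = card B \<and>
        (\<forall>e\<in>E. matching_number (E - {e}) = matching_number E) \<and>
        (\<forall>u\<in>complement_edges (A \<union> B) E. matching_number E = matching_number (insert u E))) \<and>
     (alpha_stable (A \<union> B) E \<longleftrightarrow>
        card A = card B \<and>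
        (\<forall>e\<in>E. matching_number (E - {e}) = matching_number E) \<and>
        (\<forall>u\<in>bipartite_complement_edges A B E.
           matching_number E = matching_number (insert u E))) \<and>
     (alpha_stable (A \<union> B) E \<longleftrightarrow>
        \<Inter>{S. stable_set (A \<union> B) E S \<and> card S = stability_number (A \<union> B) E} = {} \<and>
        \<Inter>{M. matching E M \<and> card M = matching_number E} = {})"
proof -
  note bip = assms(1)
  note sg = bipartite_simple[OF bip]
  let ?P = "\<exists>M. perfect_matching (A \<union> B) E M"
  let ?Q = "\<forall>e\<in>E. matching_number (E - {e}) = matching_number E"
  let ?C = "\<forall>u\<in>complement_edges (A \<union> B) E. matching_number E = matching_number (insert u E)"
  let ?B = "\<forall>u\<in>bipartite_complement_edges A B E.
    matching_number E = matching_number (insert u E)"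
  have stable: "alpha_stable (A \<union> B) E \<longleftrightarrow> ?P \<and> ?Q"
    unfolding alpha_stable_def alpha_plus_stable_iff_perfect[OF assms]
      alpha_minus_stable_iff_matching_number[OF bip] by blast
  have Q: "?Q \<longleftrightarrow> \<Inter>{M. matching E M \<and> card M = matching_number E} = {}"
    by (rule matching_number_delete_iff_Inter_maximum[OF simple_graph_finite_edges[OF sg]])
  have ii: "?P \<Longrightarrow> ?Q \<longleftrightarrow> \<Inter>{M. perfect_matching (A \<union> B) E M} = {}"
    unfolding Q perfect_iff_maximum_matching[OF bip] by (rule refl)
  have P_C: "card A = card B \<and> ?C" if ?P
    using that perfect_matching_card_classes[OF bip] perfect_matching_number_insert[OF sg] by metis
  have C_B: "?C \<Longrightarrow> ?B"
    using bipartite_complement_subset[of A B E] bip by (auto simp: bipartite_graph_def)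
  have B_P: "card A = card B \<Longrightarrow> ?B \<Longrightarrow> ?P"
    by (rule matching_number_bipartite_insert_imp_perfect[OF bip])
  have iii: "?P \<longleftrightarrow> card A = card B \<and> ?C" using P_C C_B B_P by blast
  have iv: "?P \<longleftrightarrow> card A = card B \<and> ?B" using P_C C_B B_P by blast
  show ?thesis
  proof (intro conjI)
    show "alpha_stable (A \<union> B) E \<longleftrightarrow> ?P \<and> \<Inter>{M. perfect_matching (A \<union> B) E M} = {}"
      using stable ii by blast
    show "alpha_stable (A \<union> B) E \<longleftrightarrow> card A = card B \<and> ?Q \<and> ?C"
      using stable iii by blast
    show "alpha_stable (A \<union> B) E \<longleftrightarrow> card A = card B \<and> ?Q \<and> ?B"
      using stable iv by blast
    show "alpha_stable (A \<union> B) E \<longleftrightarrow>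
        \<Inter>{S. stable_set (A \<union> B) E S \<and> card S = stability_number (A \<union> B) E} = {} \<and>
        \<Inter>{M. matching E M \<and> card M = matching_number E} = {}"
      using stable Q Inter_maximum_stable_iff_perfect[OF bip] by blast
  qed
qed

end
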